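(* Let $d \geq 1$ be an integer, let $G$ be an abelian group and let $\nu, w_1, \dots, w_{2d}: G \to [0, \infty)$ be functions with finite, non-empty supports. Then \[ E_{2d, \nu}(w_1, \dots, w_{2d}) \leq \prod_{i=1}^{2d} E_{2d, \nu}(w_i)^{1/(2d)}. \]
   Context: The group operation of the abelian group $G$ is written additively. For functions $\nu, w_1, \dots, w_{2d}: G \to [0,\infty)$ with finite, non-empty supports, the generalised additive energy is \[ E_{2d, \nu}(w_1, \dots, w_{2d}) = \sum_{y,y' \in G}\ \sum_{a_1, \dots, a_{2d} \in G } w_1(a_1) \cdots w_{2d}(a_{2d})\, \nu(y) \nu(y')\,\mathbf{1}_{\sum_{i=1}^d (a_i - a_{i+d}) = y-y'}, \] where $\mathbf{1}_P$ equals $1$ if the condition $P$ holds and $0$ otherwise. For each $1 \leq i \leq 2d$, $E_{2d,\nu}(w_i)$ denotes $E_{2d,\nu}(w_i, \dots, w_i)$, with $w_i$ repeated $2d$ times. *)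

theory Defs
  imports "HOL-Analysis.Infinite_Sum" "HOL-Library.FuncSet"
begin

text \<open>
  The tuple \<open>(a\<^sub>1, \<dots>, a\<^sub>2\<^sub>d)\<close> of elements of \<open>G\<close> is an extensional function on
  \<open>{1..2 * d}\<close>, so that distinct indices of the sum are distinct tuples. The type of \<open>G\<close> may be
  infinite, hence the unconditional sums; for finitely supported \<open>\<nu>\<close> and \<open>w i\<close> all of them have
  only finitely many nonzero terms.
\<close>

definition gen_energy ::
  "nat \<Rightarrow> ('g::ab_group_add \<Rightarrow> real) \<Rightarrow> (nat \<Rightarrow> 'g \<Rightarrow> real) \<Rightarrow> real" where
  "gen_energy d \<nu> w =
     (\<Sum>\<^sub>\<infinity>(y, y')\<in>UNIV. \<Sum>\<^sub>\<infinity>a\<in>{1..2 * d} \<rightarrow>\<^sub>E UNIV.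
        (\<Prod>i\<in>{1..2 * d}. w i (a i)) * \<nu> y * \<nu> y' *
        of_bool ((\<Sum>i\<in>{1..d}. a i - a (i + d)) = y - y'))"

definition gen_energy_diag ::
  "nat \<Rightarrow> ('g::ab_group_add \<Rightarrow> real) \<Rightarrow> ('g \<Rightarrow> real) \<Rightarrow> real" where
  "gen_energy_diag d \<nu> f = gen_energy d \<nu> (\<lambda>_. f)"

definition supp :: "('g \<Rightarrow> real) \<Rightarrow> 'g set" where
  "supp f = {x. f x \<noteq> 0}"

end

theory Submission
  imports Defs "HOL-Analysis.Convex" "HOL-Library.Poly_Mapping" "HOL-Library.Multiset"
begin

text \<open>
  In the convolution ring \<open>'g \<Rightarrow>\<^sub>0 real\<close>, with \<open>star\<close> the reflection \<open>x \<mapsto> - x\<close>, the energy is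
  the coefficient at \<open>0\<close> of \<open>N * star N * (\<Prod>i\<le>d. W i * star (W (i + d)))\<close>. The form
  \<open>(F, G) \<mapsto> (F * star G)(0)\<close> is the \<open>l\<^sup>2\<close> inner product, so Cauchy-Schwarz separates
  the first \<open>d\<close> functions from the last \<open>d\<close> and leaves the symmetric energies \<open>L(M)\<close>, where
  every \<open>W i\<close> with \<open>i\<close> in the multiset \<open>M\<close> is paired with its own reflection. Cauchy-Schwarz
  again gives \<open>L(A + {i, j})\<^sup>2 \<le> L(A + {i, i}) L(A + {j, j})\<close>, so \<open>ln L\<close> is midpoint convex on
  the multisets of size \<open>d\<close>, and hence at most the interpolation of its values at the constant
  multisets. This replaces Hoelder's inequality on the dual group.
\<close>

abbreviation "lookup \<equiv> Poly_Mapping.lookup"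
abbreviation "keys \<equiv> Poly_Mapping.keys"
abbreviation "single \<equiv> Poly_Mapping.single"

section \<open>Midpoint convexity on multisets of fixed size\<close>

text \<open>A discrete maximum principle: replacing distinct \<open>i\<close>, \<open>j\<close> in a
  maximiser by \<open>i\<close>, \<open>i\<close> or by \<open>j\<close>, \<open>j\<close> gives
  maximisers again, and the maximum is also attained at a constant multiset.\<close>

lemma midpoint_convex_multiset_nonpos:
  fixes \<phi> :: "'a multiset \<Rightarrow> real"
  assumes S: "finite S" and d: "d > 0"
    and conv: "\<And>A i j. size A + 2 = d \<Longrightarrow> set_mset A \<subseteq> S \<Longrightarrow> i \<in> S \<Longrightarrow> j \<in> S \<Longrightarrow>
      2 * \<phi> (A + {#i, j#}) \<le> \<phi> (A + {#i, i#}) + \<phi> (A + {#j, j#})"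
    and diag: "\<And>i. i \<in> S \<Longrightarrow> \<phi> (replicate_mset d i) = 0"
    and M: "M \<in> multisets_of_size S d"
  shows "\<phi> M \<le> 0"
proof -
  let ?X = "multisets_of_size S d"
  define m where "m = Max (\<phi> ` ?X)"
  define Y where "Y = {A \<in> ?X. \<phi> A = m}"
  \<comment> \<open>Among the maximisers of \<open>\<phi>\<close>, one with the largest sum of squared multiplicities is constant.\<close>
  define q :: "'a multiset \<Rightarrow> nat" where "q A = (\<Sum>i\<in>S. (count A i)\<^sup>2)" for A
  have fin: "finite ?X" using S by (rule finite_multisets_of_size)
  have le: "\<phi> A \<le> m" if "A \<in> ?X" for A
    unfolding m_def using fin that by simp
  have "m \<in> \<phi> ` ?X" unfolding m_def using fin M by (intro Max_in) auto
  hence "Y \<noteq> {}" "finite Y" using fin by (auto simp: Y_def)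
  hence "Max (q ` Y) \<in> q ` Y" by (intro Max_in) auto
  then obtain B where B: "B \<in> Y" and "q B = Max (q ` Y)" by auto
  hence Bmax: "q A \<le> q B" if "A \<in> Y" for A
    using \<open>finite Y\<close> that by simp
  have szB: "size B = d" and subB: "set_mset B \<subseteq> S" and \<phi>B: "\<phi> B = m"
    using B by (auto simp: Y_def multisets_of_size_def)
  have "B \<noteq> {#}" using szB d by auto
  then obtain i where i: "i \<in># B" by blast
  have "j = i" if j: "j \<in># B" for j
  proof (rule ccontr)
    assume ne: "j \<noteq> i"
    obtain C where C: "B = add_mset i C" using i by (blast dest: multi_member_split)
    with j ne have "j \<in># C" by auto
    then obtain A where "C = add_mset j A" by (blast dest: multi_member_split)
    with C have BA: "B = A + {#i, j#}" by simp
    have A: "size A + 2 = d" "set_mset A \<subseteq> S" "i \<in> S" "j \<in> S"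
      using szB subB by (auto simp: BA)
    have X: "A + {#i, i#} \<in> ?X" "A + {#j, j#} \<in> ?X"
      using A by (auto simp: multisets_of_size_def)
    have "\<phi> (A + {#i, i#}) = m" "\<phi> (A + {#j, j#}) = m"
      using conv[OF A] le[OF X(1)] le[OF X(2)] \<phi>B by (auto simp: BA)
    hence "A + {#i, i#} \<in> Y" "A + {#j, j#} \<in> Y"
      using X by (auto simp: Y_def)
    from this[THEN Bmax] have *: "q (A + {#i, i#}) + q (A + {#j, j#}) \<le> 2 * q B"
      by linarith
    have qi: "q C = (count C i)\<^sup>2 + (count C j)\<^sup>2 + (\<Sum>k\<in>S - {i, j}. (count C k)\<^sup>2)" for C
    proof -
      have "q C = (\<Sum>k\<in>{i, j}. (count C k)\<^sup>2) + (\<Sum>k\<in>S - {i, j}. (count C k)\<^sup>2)"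
        unfolding q_def using S A by (subst sum.subset_diff[of "{i, j}"]) auto
      thus ?thesis using ne by simp
    qed
    have "(\<Sum>k\<in>S - {i, j}. (count (A + {#i, i#}) k)\<^sup>2) = (\<Sum>k\<in>S - {i, j}. (count B k)\<^sup>2)"
      "(\<Sum>k\<in>S - {i, j}. (count (A + {#j, j#}) k)\<^sup>2) = (\<Sum>k\<in>S - {i, j}. (count B k)\<^sup>2)"
      by (auto simp: BA intro!: sum.cong split: if_splits)
    \<comment> \<open>The left side of \<open>*\<close> exceeds \<open>2 * q B\<close> by exactly 4:
      each of \<open>i\<close> and \<open>j\<close> contributes (n + 2)^2 + n^2 - 2 (n + 1)^2 = 2,
      with n its multiplicity in \<open>A\<close>.\<close>
    thus False using * ne unfolding qi by (simp add: BA power2_eq_square)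
  qed
  hence "B = replicate_mset d i"
    using szB by (metis set_mset_subset_singletonD singletonI subsetI)
  hence "m = 0" using diag i subB \<phi>B by auto
  thus ?thesis using le[OF M] by simp
qed

section \<open>Expansions in the convolution ring\<close>

lemma poly_mapping_sum_single:
  assumes "finite A" "keys F \<subseteq> A"
  shows "F = (\<Sum>a\<in>A. single a (lookup F a))"
proof (rule poly_mapping_eqI)
  fix k
  show "lookup F k = lookup (\<Sum>a\<in>A. single a (lookup F a)) k"
    using assms by (auto simp: lookup_sum lookup_single when_def in_keys_iff)
qed

lemma prod_single:
  fixes v :: "'i \<Rightarrow> 'b::comm_semiring_1" and k :: "'i \<Rightarrow> 'a::comm_monoid_add"
  shows "(\<Prod>i\<in>I. single (k i) (v i)) = single (\<Sum>i\<in>I. k i) (\<Prod>i\<in>I. v i)"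
  by (induction I rule: infinite_finite_induct) (simp_all add: mult_single)

text \<open>Supersets of the supports are allowed so that inner products can be summed over one set
  common to both functions.\<close>

lemma lookup_mult_sum:
  fixes F G :: "'a::monoid_add \<Rightarrow>\<^sub>0 'b::semiring_0"
  assumes "finite A" "keys F \<subseteq> A" "finite B" "keys G \<subseteq> B"
  shows "lookup (F * G) x = (\<Sum>a\<in>A. \<Sum>b\<in>B. lookup F a * lookup G b when a + b = x)"
proof -
  have "F * G = (\<Sum>a\<in>A. \<Sum>b\<in>B. single (a + b) (lookup F a * lookup G b))"
    by (subst poly_mapping_sum_single[OF assms(1,2)], subst poly_mapping_sum_single[OF assms(3,4)])
      (simp add: sum_product mult_single)
  thus ?thesis by (simp add: lookup_sum lookup_single)
qed

section \<open>Reflection and the inner product\<close>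

text \<open>For real coefficients this is complex conjugation on the Fourier side.\<close>

definition star :: "('a::ab_group_add \<Rightarrow>\<^sub>0 'b::zero) \<Rightarrow> 'a \<Rightarrow>\<^sub>0 'b" where
  "star = Poly_Mapping.map_key uminus"

lemma lookup_star [simp]: "lookup (star F) x = lookup F (- x)"
  unfolding star_def by (subst map_key.rep_eq) simp_all

lemma keys_star: "keys (star F) = uminus ` keys F"
  by (force simp: in_keys_iff image_iff)

lemma star_star [simp]: "star (star F) = F"
  by (rule poly_mapping_eqI) simp

lemma star_single: "star (single a v) = single (- a) v"
  by (rule poly_mapping_eqI) (auto simp: lookup_single when_def)

lemma star_sum: "star (\<Sum>i\<in>I. F i) = (\<Sum>i\<in>I. star (F i))"
  by (rule poly_mapping_eqI) (simp add: lookup_sum)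

lemma star_one [simp]: "star (1 :: 'a::ab_group_add \<Rightarrow>\<^sub>0 'b::zero_neq_one) = 1"
  using star_single[of "0 :: 'a" "1 :: 'b"] by simp

text \<open>Negation is an endomorphism of the abelian group, which settles the case of two
  \<open>single\<close>s; bilinearity does the rest.\<close>

lemma star_mult:
  fixes F G :: "'a::ab_group_add \<Rightarrow>\<^sub>0 'b::semiring_0"
  shows "star (F * G) = star F * star G"
proof -
  have star_mult_sums: "star ((\<Sum>a\<in>A. single a (f a)) * (\<Sum>b\<in>B. single b (g b))) =
      star (\<Sum>a\<in>A. single a (f a)) * star (\<Sum>b\<in>B. single b (g b))"
    for A B :: "'a set" and f g :: "'a \<Rightarrow> 'b"
    by (simp add: sum_product star_sum mult_single star_single add.commute)
  have F: "F = (\<Sum>a\<in>keys F. single a (lookup F a))"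
    and G: "G = (\<Sum>a\<in>keys G. single a (lookup G a))"
    by (intro poly_mapping_sum_single; simp)+
  show ?thesis
    using star_mult_sums[where A = "keys F" and f = "lookup F" and B = "keys G" and g = "lookup G"]
    by (simp only: F[symmetric] G[symmetric])
qed

lemma star_prod:
  fixes F :: "'i \<Rightarrow> 'a::ab_group_add \<Rightarrow>\<^sub>0 'b::comm_semiring_1"
  shows "star (\<Prod>i\<in>I. F i) = (\<Prod>i\<in>I. star (F i))"
  by (induction I rule: infinite_finite_induct) (simp_all add: star_mult)

lemma star_prod_mset:
  fixes F :: "'i \<Rightarrow> 'a::ab_group_add \<Rightarrow>\<^sub>0 'b::comm_semiring_1"
  shows "star (\<Prod>i\<in>#I. F i) = (\<Prod>i\<in>#I. star (F i))"
  by (induction I) (simp_all add: star_mult)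

text \<open>Negating the second summation variable turns \<open>a + b = 0\<close> into
  \<open>a = b\<close>, so only the diagonal survives.\<close>

lemma lookup_mult_star_0:
  fixes F G :: "'a::ab_group_add \<Rightarrow>\<^sub>0 'b::semiring_0"
  assumes "finite A" "keys F \<subseteq> A" "keys G \<subseteq> A"
  shows "lookup (F * star G) 0 = (\<Sum>a\<in>A. lookup F a * lookup G a)"
proof -
  have "lookup (F * star G) 0 =
      (\<Sum>a\<in>A. \<Sum>b\<in>uminus ` A. lookup F a * lookup (star G) b when a + b = 0)"
    using assms by (intro lookup_mult_sum) (auto simp: keys_star)
  also have "\<dots> = (\<Sum>a\<in>A. \<Sum>b\<in>A. if a = b then lookup F a * lookup G b else 0)"
    by (subst sum.reindex) (auto simp: inj_on_def when_def intro!: sum.cong)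
  finally show ?thesis using assms(1) by simp
qed

lemma star_Cauchy_Schwarz:
  fixes F G :: "'a::ab_group_add \<Rightarrow>\<^sub>0 real"
  shows "(lookup (F * star G) 0)\<^sup>2 \<le> lookup (F * star F) 0 * lookup (G * star G) 0"
proof -
  let ?A = "keys F \<union> keys G"
  show ?thesis
    using Cauchy_Schwarz_ineq_sum[of "lookup F" "lookup G" ?A]
    by (simp add: lookup_mult_star_0[of ?A] power2_eq_square)
qed

lemma lookup_mult_star_self_pos:
  fixes F :: "'a::ab_group_add \<Rightarrow>\<^sub>0 real"
  assumes "F \<noteq> 0"
  shows "lookup (F * star F) 0 > 0"
proof -
  have "keys F \<noteq> {}" using assms by simp
  thus ?thesis
    by (subst lookup_mult_star_0[of "keys F"])
      (auto intro!: sum_pos simp: in_keys_iff zero_less_mult_iff neq_iff)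
qed

section \<open>Products of nonnegative nonzero elements\<close>

text \<open>The conditions on \<nu> and the weights; finiteness of the support is carried by the
  type.\<close>

definition nonneg_nonzero :: "('a \<Rightarrow>\<^sub>0 real) \<Rightarrow> bool" where
  "nonneg_nonzero F \<longleftrightarrow> (\<forall>x. lookup F x \<ge> 0) \<and> F \<noteq> 0"

text \<open>Nonnegative terms cannot cancel, so the coefficient at \<open>a + b\<close> is at least
  the single positive term from \<open>a\<close> and \<open>b\<close>. Over a group with torsion the
  ring has zero divisors, so being nonzero would not suffice.\<close>

lemma nonneg_nonzero_mult:
  fixes F G :: "'a::monoid_add \<Rightarrow>\<^sub>0 real"
  assumes "nonneg_nonzero F" "nonneg_nonzero G"
  shows "nonneg_nonzero (F * G)"
proof -
  let ?A = "keys F" and ?B = "keys G"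
  have eq: "lookup (F * G) x = (\<Sum>a\<in>?A. \<Sum>b\<in>?B. lookup F a * lookup G b when a + b = x)" for x
    by (rule lookup_mult_sum) auto
  have nn: "(lookup F a * lookup G b when a + b = x) \<ge> 0" for a b x
    using assms by (simp add: nonneg_nonzero_def when_def)
  obtain a b where ab: "a \<in> ?A" "b \<in> ?B"
    using assms by (metis nonneg_nonzero_def keys_eq_empty ex_in_conv)
  have "0 < lookup F a * lookup G b"
    using assms ab by (auto simp: nonneg_nonzero_def in_keys_iff zero_less_mult_iff order.order_iff_strict)
  also have "\<dots> \<le> (\<Sum>b'\<in>?B. lookup F a * lookup G b' when a + b' = a + b)"
    using member_le_sum[of b ?B "\<lambda>b'. lookup F a * lookup G b' when a + b' = a + b"] ab nn by simp
  also have "\<dots> \<le> lookup (F * G) (a + b)"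
    unfolding eq
    using member_le_sum[of a ?A "\<lambda>a'. \<Sum>b'\<in>?B. lookup F a' * lookup G b' when a' + b' = a + b"] ab nn
    by (simp add: sum_nonneg)
  finally have "F * G \<noteq> 0" by auto
  moreover have "lookup (F * G) x \<ge> 0" for x
    unfolding eq by (intro sum_nonneg nn)
  ultimately show ?thesis by (simp add: nonneg_nonzero_def)
qed

lemma nonneg_nonzero_one: "nonneg_nonzero (1 :: 'a::monoid_add \<Rightarrow>\<^sub>0 real)"
  by (simp add: nonneg_nonzero_def lookup_one when_def)

lemma nonneg_nonzero_prod_mset:
  fixes F :: "'i \<Rightarrow> 'a::comm_monoid_add \<Rightarrow>\<^sub>0 real"
  assumes "\<And>i. i \<in># M \<Longrightarrow> nonneg_nonzero (F i)"
  shows "nonneg_nonzero (\<Prod>i\<in>#M. F i)"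
  using assms by (induction M) (auto intro: nonneg_nonzero_mult nonneg_nonzero_one)

section \<open>Symmetric energies and their log-convexity\<close>

text \<open>
  In Fourier terms: the integral over the dual group of the product of the squared moduli of the
  transforms of \<open>N\<close> and of the \<open>W i\<close>.
\<close>
definition sym_energy ::
  "('a::ab_group_add \<Rightarrow>\<^sub>0 real) \<Rightarrow> ('i \<Rightarrow> 'a \<Rightarrow>\<^sub>0 real) \<Rightarrow> 'i multiset \<Rightarrow> real" where
  "sym_energy N W M = lookup (N * star N * (\<Prod>i\<in>#M. W i * star (W i))) 0"

text \<open>Regrouping the commuting factors exhibits a squared l2 norm.\<close>

lemma sym_energy_eq:
  "sym_energy N W M = lookup ((N * (\<Prod>i\<in>#M. W i)) * star (N * (\<Prod>i\<in>#M. W i))) 0"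
  by (simp add: sym_energy_def star_mult star_prod_mset prod_mset.distrib ac_simps)

lemma sym_energy_midpoint:
  "(sym_energy N W (A + {#i, j#}))\<^sup>2
    \<le> sym_energy N W (A + {#i, i#}) * sym_energy N W (A + {#j, j#})"
proof -
  let ?B = "N * (\<Prod>i\<in>#A. W i)"
  \<comment> \<open>\<open>W l * star (W l)\<close> is fixed by \<open>star\<close>, so it can be
    moved into the second argument of the inner product.\<close>
  have "sym_energy N W (A + {#k, l#})
      = lookup ((?B * (W k * star (W k))) * star (?B * (W l * star (W l)))) 0" for k l
    by (simp add: sym_energy_def star_mult star_prod_mset prod_mset.distrib ac_simps)
  thus ?thesis using star_Cauchy_Schwarz by metis
qed

lemma sym_energy_pos:
  assumes "nonneg_nonzero N" "\<And>i. i \<in># M \<Longrightarrow> nonneg_nonzero (W i)"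
  shows "sym_energy N W M > 0"
  unfolding sym_energy_eq
  using nonneg_nonzero_mult[OF assms(1) nonneg_nonzero_prod_mset, of M W] assms(2)
  by (intro lookup_mult_star_self_pos) (simp add: nonneg_nonzero_def)

text \<open>The case where each index occurs once. The index set is arbitrary so that it can be
  either half of \<open>{1..2 * d}\<close>.\<close>

lemma sym_energy_le_prod:
  assumes S: "finite S" "S \<noteq> {}"
    and N: "nonneg_nonzero N" and W: "\<And>i. i \<in> S \<Longrightarrow> nonneg_nonzero (W i)"
  shows "sym_energy N W (mset_set S)
    \<le> (\<Prod>i\<in>S. sym_energy N W (replicate_mset (card S) i) powr (1 / real (card S)))"
proof -
  define d where "d = card S"
  define D where "D i = sym_energy N W (replicate_mset d i)" for i
  \<comment> \<open>The subtracted term is additive in \<open>M\<close> and equals the logarithm at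
    constant multisets of size \<open>d\<close>. Hence \<open>\<phi>\<close> vanishes there, and the
    correction cancels in the midpoint inequality.\<close>
  define \<phi> where "\<phi> M = ln (sym_energy N W M) - (\<Sum>i\<in>#M. ln (D i) / real d)" for M
  have d: "d > 0" using S by (simp add: d_def card_gt_0_iff)
  have pos: "sym_energy N W M > 0" if "set_mset M \<subseteq> S" for M
    using that W by (intro sym_energy_pos N) auto
  have Dpos: "D i > 0" if "i \<in> S" for i
    unfolding D_def using that by (intro pos) (auto split: if_splits)
  have "\<phi> (mset_set S) \<le> 0"
  proof (rule midpoint_convex_multiset_nonpos[OF S(1) d])
    show "mset_set S \<in> multisets_of_size S d"
      using S by (simp add: multisets_of_size_def d_def)
    show "\<phi> (replicate_mset d i) = 0" for i
      using d by (simp add: \<phi>_def D_def sum_mset_replicate_mset)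
  next
    fix A i j assume A: "set_mset A \<subseteq> S" "i \<in> S" "j \<in> S"
    have p: "sym_energy N W (A + {#i, j#}) > 0" "sym_energy N W (A + {#i, i#}) > 0"
      "sym_energy N W (A + {#j, j#}) > 0"
      using A by (intro pos; auto)+
    have "2 * ln (sym_energy N W (A + {#i, j#})) = ln ((sym_energy N W (A + {#i, j#}))\<^sup>2)"
      using p by (simp add: ln_realpow)
    also have "\<dots> \<le> ln (sym_energy N W (A + {#i, i#}) * sym_energy N W (A + {#j, j#}))"
      using p by (intro ln_mono sym_energy_midpoint) auto
    also have "\<dots> = ln (sym_energy N W (A + {#i, i#})) + ln (sym_energy N W (A + {#j, j#}))"
      using p by (intro ln_mult_pos)
    finally show "2 * \<phi> (A + {#i, j#}) \<le> \<phi> (A + {#i, i#}) + \<phi> (A + {#j, j#})"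
      by (simp add: \<phi>_def)
  qed
  hence "ln (sym_energy N W (mset_set S)) \<le> (\<Sum>i\<in>S. ln (D i) / real d)"
    by (simp add: \<phi>_def sum_unfold_sum_mset)
  also have "\<dots> = ln (\<Prod>i\<in>S. D i powr (1 / real d))"
    using S Dpos by (subst ln_prod) (auto simp: ln_powr less_imp_neq[symmetric] intro!: sum.cong)
  finally have "sym_energy N W (mset_set S) \<le> (\<Prod>i\<in>S. D i powr (1 / real d))"
    using S Dpos pos[of "mset_set S"] by (subst (asm) ln_le_cancel_iff) (auto intro!: prod_pos simp: less_imp_neq[symmetric])
  thus ?thesis by (simp add: D_def d_def)
qed

section \<open>The energy as a coefficient of a convolution product\<close>

lemma prod_two_halves:
  fixes f :: "nat \<Rightarrow> 'a::comm_monoid_mult"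
  shows "(\<Prod>i\<in>{1..2 * d}. f i) = (\<Prod>i\<in>{1..d}. f i * f (i + d))"
  using prod.ub_add_nat[of 1 d f d] prod.shift_bounds_cl_nat_ivl[of f 1 d d]
  by (simp add: mult_2 prod.distrib add.commute)

lemma sum_two_halves:
  fixes f :: "nat \<Rightarrow> 'a::comm_monoid_add"
  shows "(\<Sum>i\<in>{1..2 * d}. f i) = (\<Sum>i\<in>{1..d}. f i + f (i + d))"
  using sum.ub_add_nat[of 1 d f d] sum.shift_bounds_cl_nat_ivl[of f 1 d d]
  by (simp add: mult_2 sum.distrib add.commute)

text \<open>Expanding the product gives one monomial for each choice of \<open>y\<close>,
  \<open>y'\<close> and \<open>a\<close> in the supports; the coefficient at 0 selects those
  satisfying the constraint of the energy.\<close>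

lemma gen_energy_eq_lookup:
  fixes N :: "'g::ab_group_add \<Rightarrow>\<^sub>0 real"
  assumes "\<And>i. i \<in> {1..2 * d} \<Longrightarrow> w i = lookup (W i)"
  shows "gen_energy d (lookup N) w
    = lookup (N * star N * (\<Prod>i\<in>{1..d}. W i * star (W (i + d)))) 0"
proof -
  let ?K = "keys N" and ?P = "PiE {1..2 * d} (\<lambda>i. keys (W i))"
  \<comment> \<open>Putting the sign into each index turns the paired product into one over
    \<open>{1..2 * d}\<close>, which distributes over extensional tuples.\<close>
  define t where "t i = (if i \<le> d then id else uminus :: 'g \<Rightarrow> 'g)" for i
  define V where "V i = (if i \<le> d then W i else star (W i))" for i
  have finP: "finite ?P" by (intro finite_PiE) auto
  have V: "V i = (\<Sum>a\<in>keys (W i). single (t i a) (lookup (W i) a))" for i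
  proof -
    have "W i = (\<Sum>a\<in>keys (W i). single a (lookup (W i) a))"
      by (intro poly_mapping_sum_single) auto
    hence "V i = (if i \<le> d then (\<Sum>a\<in>keys (W i). single a (lookup (W i) a))
        else star (\<Sum>a\<in>keys (W i). single a (lookup (W i) a)))"
      by (simp only: V_def)
    also have "\<dots> = (\<Sum>a\<in>keys (W i). single (t i a) (lookup (W i) a))"
      by (simp add: t_def star_sum star_single)
    finally show ?thesis .
  qed
  have t: "(\<Sum>i\<in>{1..2 * d}. t i (a i)) = (\<Sum>i\<in>{1..d}. a i - a (i + d))" for a :: "nat \<Rightarrow> 'g"
    unfolding sum_two_halves by (intro sum.cong) (auto simp: t_def)
  have "(\<Prod>i\<in>{1..d}. W i * star (W (i + d))) = (\<Prod>i\<in>{1..2 * d}. V i)"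
    unfolding prod_two_halves by (intro prod.cong) (auto simp: V_def)
  also have "\<dots> = (\<Sum>a\<in>?P. \<Prod>i\<in>{1..2 * d}. single (t i (a i)) (lookup (W i) (a i)))"
    unfolding V by (subst prod_sum_PiE) auto
  also have "\<dots> = (\<Sum>a\<in>?P. single (\<Sum>i\<in>{1..d}. a i - a (i + d)) (\<Prod>i\<in>{1..2 * d}. w i (a i)))"
    unfolding prod_single t using assms by (intro sum.cong) auto
  finally have P: "(\<Prod>i\<in>{1..d}. W i * star (W (i + d))) = \<dots>" .
  have N: "N = (\<Sum>y\<in>?K. single y (lookup N y))"
    by (intro poly_mapping_sum_single) auto
  have N': "star N = (\<Sum>y\<in>?K. single (- y) (lookup N y))"
    by (subst N) (simp add: star_sum star_single)
  \<comment> \<open>Here \<open>y\<close> comes from \<open>star N\<close> and \<open>y'\<close>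
    from \<open>N\<close>, which gives the constraint its sign \<open>y - y'\<close>.\<close>
  have NN: "N * star N = (\<Sum>(y, y')\<in>?K \<times> ?K. single (y' - y) (lookup N y * lookup N y'))"
    unfolding sum.cartesian_product[symmetric]
    using arg_cong2[OF N' N, of times] by (simp add: sum_product mult_single mult.commute[of N "star N"])
  have "N * star N * (\<Prod>i\<in>{1..d}. W i * star (W (i + d))) =
      (\<Sum>(y, y')\<in>?K \<times> ?K. \<Sum>a\<in>?P. single (y' - y + (\<Sum>i\<in>{1..d}. a i - a (i + d)))
        (lookup N y * lookup N y' * (\<Prod>i\<in>{1..2 * d}. w i (a i))))"
    unfolding P NN by (simp add: sum_product mult_single case_prod_beta)
  hence "lookup (N * star N * (\<Prod>i\<in>{1..d}. W i * star (W (i + d)))) 0 =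
      (\<Sum>(y, y')\<in>?K \<times> ?K. \<Sum>a\<in>?P. (\<Prod>i\<in>{1..2 * d}. w i (a i)) * lookup N y * lookup N y' *
        of_bool ((\<Sum>i\<in>{1..d}. a i - a (i + d)) = y - y'))"
    by (auto simp: lookup_sum lookup_single when_def case_prod_beta algebra_simps
        eq_diff_eq diff_eq_eq intro!: sum.cong)
  \<comment> \<open>Outside \<open>?P\<close> some factor \<open>w i (a i)\<close> vanishes, so the
    finite sum equals the unconditional one; the sum over \<open>y\<close>, \<open>y'\<close> is
    extended likewise afterwards.\<close>
  also have "\<dots> = (\<Sum>(y, y')\<in>?K \<times> ?K. \<Sum>\<^sub>\<infinity>a\<in>{1..2 * d} \<rightarrow>\<^sub>E UNIV.
      (\<Prod>i\<in>{1..2 * d}. w i (a i)) * lookup N y * lookup N y' *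
        of_bool ((\<Sum>i\<in>{1..d}. a i - a (i + d)) = y - y'))"
  proof (intro sum.cong refl, clarify)
    fix y y'
    let ?f = "\<lambda>a. (\<Prod>i\<in>{1..2 * d}. w i (a i)) * lookup N y * lookup N y' *
        of_bool ((\<Sum>i\<in>{1..d}. a i - a (i + d)) = y - y')"
    have "sum ?f ?P = infsum ?f ?P" using finP by simp
    also have "\<dots> = infsum ?f ({1..2 * d} \<rightarrow>\<^sub>E UNIV)"
    proof (intro infsum_cong_neutral)
      fix a assume "a \<in> ({1..2 * d} \<rightarrow>\<^sub>E UNIV) - ?P"
      then obtain i where "i \<in> {1..2 * d}" "w i (a i) = 0"
        using assms by (auto simp: PiE_iff in_keys_iff)
      hence "(\<Prod>i\<in>{1..2 * d}. w i (a i)) = 0" by (meson finite_atLeastAtMost prod_zero)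
      thus "?f a = 0" by simp
    qed auto
    finally show "sum ?f ?P = infsum ?f ({1..2 * d} \<rightarrow>\<^sub>E UNIV)" .
  qed
  also have "\<dots> = gen_energy d (lookup N) w"
    unfolding gen_energy_def
    by (subst infsum_finite[symmetric], simp, intro infsum_cong_neutral) (auto simp: in_keys_iff)
  finally show ?thesis by simp
qed

section \<open>Separation of the two halves and conclusion\<close>

theorem theorem1p1:
  fixes d :: nat
    and \<nu> :: "'g::ab_group_add \<Rightarrow> real"
    and w :: "nat \<Rightarrow> 'g \<Rightarrow> real"
  assumes "d \<ge> 1"
    and "\<And>x. \<nu> x \<ge> 0" and "finite (supp \<nu>)" and "supp \<nu> \<noteq> {}"
    and "\<And>i x. i \<in> {1..2 * d} \<Longrightarrow> w i x \<ge> 0"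
    and "\<And>i. i \<in> {1..2 * d} \<Longrightarrow> finite (supp (w i))"
    and "\<And>i. i \<in> {1..2 * d} \<Longrightarrow> supp (w i) \<noteq> {}"
  shows "gen_energy d \<nu> w
    \<le> (\<Prod>i\<in>{1..2 * d}. gen_energy_diag d \<nu> (w i) powr (1 / (2 * real d)))"
proof -
  have lift: "lookup (Abs_poly_mapping f) = f \<and> nonneg_nonzero (Abs_poly_mapping f)"
    if "\<And>x. f x \<ge> 0" "finite (supp f)" "supp f \<noteq> {}" for f :: "'g \<Rightarrow> real"
  proof -
    have *: "lookup (Abs_poly_mapping f) = f" using that by (simp add: supp_def)
    moreover have "Abs_poly_mapping f \<noteq> 0" using that(3) * by (auto simp: supp_def)
    ultimately show ?thesis using that(1) by (simp add: nonneg_nonzero_def)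
  qed
  define N where "N = Abs_poly_mapping \<nu>"
  define W where "W i = Abs_poly_mapping (w i)" for i
  have N: "\<nu> = lookup N" "nonneg_nonzero N" using lift[OF assms(2-4)] by (auto simp: N_def)
  have W: "w i = lookup (W i)" "nonneg_nonzero (W i)" if "i \<in> {1..2 * d}" for i
    using lift[OF assms(5-7)] that by (auto simp: W_def)
  let ?D = "\<lambda>i. sym_energy N W (replicate_mset d i)"
  \<comment> \<open>For a constant family the product over \<open>{1..d}\<close> is the
    \<open>d\<close>-th power of \<open>W i * star (W i)\<close>, as for
    \<open>replicate_mset d i\<close>.\<close>
  have diag: "gen_energy_diag d \<nu> (w i) = ?D i" if "i \<in> {1..2 * d}" for i
    unfolding gen_energy_diag_def N(1) sym_energy_def
    by (subst gen_energy_eq_lookup[where W = "\<lambda>_. W i"]) (use W(1)[OF that] in simp_all)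
  have Dnn: "?D i \<ge> 0" if "i \<in> {1..2 * d}" for i
    using W(2) that N(2) by (intro less_imp_le sym_energy_pos) (auto split: if_splits)
  have bound: "sym_energy N W (mset_set S) \<le> (\<Prod>i\<in>S. ?D i powr (1 / real d))"
    if "S \<subseteq> {1..2 * d}" "card S = d" for S
    using sym_energy_le_prod[of S N W] that assms(1) N(2) W(2) finite_subset[OF that(1)] by fastforce
  let ?S = "{1..d}" and ?T = "{1 + d..d + d}"
  let ?F = "N * (\<Prod>i\<in>?S. W i)" and ?G = "N * (\<Prod>i\<in>?T. W i)"
  have T: "(\<Prod>i\<in>?S. W (i + d)) = (\<Prod>i\<in>?T. W i)"
    using prod.shift_bounds_cl_nat_ivl[of W 1 d d] by simp
  have "gen_energy d \<nu> w = lookup (N * star N * (\<Prod>i\<in>?S. W i * star (W (i + d)))) 0"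
    unfolding N(1) by (rule gen_energy_eq_lookup) (rule W(1))
  \<comment> \<open>\<open>N\<close> joins the first half and \<open>star N\<close> the reflected
    second half, so that Cauchy-Schwarz applies.\<close>
  also have "\<dots> = lookup (?F * star ?G) 0"
    unfolding T[symmetric] by (simp add: star_mult star_prod prod.distrib ac_simps)
  finally have "(gen_energy d \<nu> w)\<^sup>2 \<le> lookup (?F * star ?F) 0 * lookup (?G * star ?G) 0"
    using star_Cauchy_Schwarz by metis
  also have "\<dots> = sym_energy N W (mset_set ?S) * sym_energy N W (mset_set ?T)"
    by (simp add: sym_energy_eq prod_unfold_prod_mset)
  also have "\<dots> \<le> (\<Prod>i\<in>?S. ?D i powr (1 / real d)) * (\<Prod>i\<in>?T. ?D i powr (1 / real d))"
    using N(2) W(2) by (intro mult_mono bound prod_nonneg less_imp_le[OF sym_energy_pos]) auto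
  also have "\<dots> = (\<Prod>i\<in>{1..2 * d}. ?D i powr (1 / real d))"
    using prod.ub_add_nat[of 1 d "\<lambda>i. ?D i powr (1 / real d)" d] by (simp add: mult_2)
  \<comment> \<open>Halving the exponents displays the bound as the square of a nonnegative number,
    so square roots can be taken.\<close>
  also have "\<dots> = (\<Prod>i\<in>{1..2 * d}. ?D i powr (1 / (2 * real d)))\<^sup>2"
    unfolding prod_power_distrib
    by (intro prod.cong refl) (simp add: power2_eq_square powr_add[symmetric])
  finally have "gen_energy d \<nu> w \<le> (\<Prod>i\<in>{1..2 * d}. ?D i powr (1 / (2 * real d)))"
    by (rule power2_le_imp_le) (intro prod_nonneg, auto)
  thus ?thesis using diag by simp
qed

end
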